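(* Let $A\in\mathbb{R}^{n\times n}$ be an $\tilde{E}_0^s$-matrix. Assume that every legitimate principal pivot transform of $A$ is either an almost $E$ matrix or a completely $\tilde{E}_0^s$-matrix. Then $A$ is a $P_0$-matrix.
   Context: Vector inequalities are componentwise. Classes (for a square real matrix $B$ of order $m$): $B$ is $P_0$ if all its principal minors are nonnegative. $B$ is semimonotone ($E_0$) if for every $0\neq x\ge 0$ there is $i$ with $x_i>0$ and $(Bx)_i\ge 0$. $B$ is strictly semimonotone ($E$) if for every $0\neq x\ge 0$ there is $i$ with $x_i>0$ and $(Bx)_i>0$. $B$ is almost $E$ if it is $E$ of order $m-1$ but not of order $m$, i.e. all principal submatrices of $B$ of order $m-1$ are $E$ but $B$ is not $E$. $B\in E_0^s$ (semimonotone star) if $B\in E_0$ and $x\ge 0$, $Bx\ge 0$, $x^TBx=0$ imply $B^Tx\le 0$. $B\in\tilde{E}_0^s$ if $B\in E_0^s$ and for every $x\in \mathrm{SOL}(0,B)=\{x\ge 0: Bx\ge 0,\ x^TBx=0\}$ and every index $i$, $(B^Tx)_i\neq 0$ implies $(Bx)_i\neq 0$. $B$ is completely $\tilde{E}_0^s$ if all its principal submatrices (including $B$) are $\tilde{E}_0^s$-matrices. Principal pivot transform (PPT): for $\alpha\subseteq\{1,\dots,n\}$ with $\det A_{\alpha\alpha}\neq 0$, the PPT of $A$ with respect to $\alpha$ is the matrix $M$ with blocks $M_{\alpha\alpha}=(A_{\alpha\alpha})^{-1}$, $M_{\alpha\bar\alpha}=-(A_{\alpha\alpha})^{-1}A_{\alpha\bar\alpha}$,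 $M_{\bar\alpha\alpha}=A_{\bar\alpha\alpha}(A_{\alpha\alpha})^{-1}$, $M_{\bar\alpha\bar\alpha}=A_{\bar\alpha\bar\alpha}-A_{\bar\alpha\alpha}(A_{\alpha\alpha})^{-1}A_{\alpha\bar\alpha}$, where $\bar\alpha$ is the complement of $\alpha$; for $\alpha=\emptyset$, $\det A_{\alpha\alpha}=1$ by convention and $M=A$. The legitimate PPTs of $A$ are all the matrices so obtained. *)

theory Defs
  imports
    "Jordan_Normal_Form.Determinant"
    "Jordan_Normal_Form.Gauss_Jordan_Elimination"
    "Jordan_Normal_Form.DL_Submatrix"
begin

(* The classes below are meant for square matrices; indices are 0-based, so the index set of a
   matrix B of order m = dim_row B is {..<m}.  The order on vectors is the componentwise one. *)

abbreviation principal_submatrix :: "'a mat \<Rightarrow> nat set \<Rightarrow> 'a mat" where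
  "principal_submatrix B S \<equiv> submatrix B S S"

(* S = {} is harmless here and in the classes below: the empty determinant is 1, and the matrix of
   order 0 belongs to every class defined by a condition on vectors. *)
definition P0_matrix :: "real mat \<Rightarrow> bool" where
  "P0_matrix B \<longleftrightarrow> (\<forall>S \<subseteq> {..<dim_row B}. 0 \<le> det (principal_submatrix B S))"

definition semimonotone :: "real mat \<Rightarrow> bool" where
  "semimonotone B \<longleftrightarrow>
    (\<forall>x \<in> carrier_vec (dim_row B). x \<noteq> 0\<^sub>v (dim_row B) \<and> 0\<^sub>v (dim_row B) \<le> x \<longrightarrow>
      (\<exists>i < dim_row B. x $ i > 0 \<and> (B *\<^sub>v x) $ i \<ge> 0))"

definition strictly_semimonotone :: "real mat \<Rightarrow> bool" where
  "strictly_semimonotone B \<longleftrightarrow>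
    (\<forall>x \<in> carrier_vec (dim_row B). x \<noteq> 0\<^sub>v (dim_row B) \<and> 0\<^sub>v (dim_row B) \<le> x \<longrightarrow>
      (\<exists>i < dim_row B. x $ i > 0 \<and> (B *\<^sub>v x) $ i > 0))"

definition almost_E :: "real mat \<Rightarrow> bool" where
  "almost_E B \<longleftrightarrow>
    (\<forall>S \<subseteq> {..<dim_row B}. Suc (card S) = dim_row B \<longrightarrow>
      strictly_semimonotone (principal_submatrix B S)) \<and>
    \<not> strictly_semimonotone B"

(* SOL(0,B), the solution set of the linear complementarity problem with zero vector q *)
definition SOL0 :: "real mat \<Rightarrow> real vec set" where
  "SOL0 B = {x \<in> carrier_vec (dim_row B).
     0\<^sub>v (dim_row B) \<le> x \<and> 0\<^sub>v (dim_row B) \<le> B *\<^sub>v x \<and> x \<bullet> (B *\<^sub>v x) = 0}"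

definition semimonotone_star :: "real mat \<Rightarrow> bool" where
  "semimonotone_star B \<longleftrightarrow>
    semimonotone B \<and> (\<forall>x \<in> SOL0 B. transpose_mat B *\<^sub>v x \<le> 0\<^sub>v (dim_row B))"

definition semimonotone_star_tilde :: "real mat \<Rightarrow> bool" where
  "semimonotone_star_tilde B \<longleftrightarrow>
    semimonotone_star B \<and>
    (\<forall>x \<in> SOL0 B. \<forall>i < dim_row B.
      (transpose_mat B *\<^sub>v x) $ i \<noteq> 0 \<longrightarrow> (B *\<^sub>v x) $ i \<noteq> 0)"

definition completely_semimonotone_star_tilde :: "real mat \<Rightarrow> bool" where
  "completely_semimonotone_star_tilde B \<longleftrightarrow>
    (\<forall>S \<subseteq> {..<dim_row B}. semimonotone_star_tilde (principal_submatrix B S))"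

(* Meaningful only if the principal submatrix on \<alpha> is invertible.  The blocks are put back at the
   original positions: an index i in S is row (or column) card {a \<in> S. a < i} of a block
   indexed by S; see the lemma ppt_blocks. *)
definition ppt :: "real mat \<Rightarrow> nat set \<Rightarrow> real mat" where
  "ppt A \<alpha> =
    (let n = dim_row A;
         \<beta> = {..<n} - \<alpha>;
         N = the (mat_inverse (submatrix A \<alpha> \<alpha>));
         pos = (\<lambda>S i. card {a \<in> S. a < i})
     in mat n n (\<lambda>(i, j).
       if i \<in> \<alpha> then
         if j \<in> \<alpha> then N $$ (pos \<alpha> i, pos \<alpha> j)
         else (- (N * submatrix A \<alpha> \<beta>)) $$ (pos \<alpha> i, pos \<beta> j)
       else
         if j \<in> \<alpha> then (submatrix A \<beta> \<alpha> * N) $$ (pos \<beta> i, pos \<alpha> j)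
         else (submatrix A \<beta> \<beta> - submatrix A \<beta> \<alpha> * N * submatrix A \<alpha> \<beta>) $$ (pos \<beta> i, pos \<beta> j)))"

definition legitimate_ppts :: "real mat \<Rightarrow> real mat set" where
  "legitimate_ppts A =
    {ppt A \<alpha> | \<alpha>. \<alpha> \<subseteq> {..<dim_row A} \<and> det (principal_submatrix A \<alpha>) \<noteq> 0}"

lemma ppt_blocks:
  assumes A: "A \<in> carrier_mat n n" and sub: "\<alpha> \<subseteq> {..<n}"
    and det: "det (principal_submatrix A \<alpha>) \<noteq> 0"
  defines "\<beta> \<equiv> {..<n} - \<alpha>"
  obtains N where
    "inverts_mat (submatrix A \<alpha> \<alpha>) N" "inverts_mat N (submatrix A \<alpha> \<alpha>)"
    "ppt A \<alpha> \<in> carrier_mat n n"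
    "submatrix (ppt A \<alpha>) \<alpha> \<alpha> = N"
    "submatrix (ppt A \<alpha>) \<alpha> \<beta> = - (N * submatrix A \<alpha> \<beta>)"
    "submatrix (ppt A \<alpha>) \<beta> \<alpha> = submatrix A \<beta> \<alpha> * N"
    "submatrix (ppt A \<alpha>) \<beta> \<beta> = submatrix A \<beta> \<beta> - submatrix A \<beta> \<alpha> * N * submatrix A \<alpha> \<beta>"
proof -
  define N where "N = the (mat_inverse (submatrix A \<alpha> \<alpha>))"
  have dims: "dim_row A = n" "dim_col A = n" using A by auto
  have set_eq: "{i. i < n \<and> i \<in> \<alpha>} = \<alpha>" "{i. i < n \<and> i \<in> \<beta>} = \<beta>"
    using sub by (auto simp: \<beta>_def)
  have C: "submatrix A S T \<in> carrier_mat (card {i. i < n \<and> i \<in> S}) (card {i. i < n \<and> i \<in> T})" for S T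
    unfolding submatrix_def dims by simp
  have Aaa: "submatrix A \<alpha> \<alpha> \<in> carrier_mat (card \<alpha>) (card \<alpha>)" using C[of \<alpha> \<alpha>] set_eq by simp
  have "submatrix A \<alpha> \<alpha> \<in> Units (ring_mat TYPE(real) (card \<alpha>) ())"
    using det_non_zero_imp_unit[OF Aaa det] .
  then obtain N' where "mat_inverse (submatrix A \<alpha> \<alpha>) = Some N'"
    using mat_inverse(1)[OF Aaa, where b = "()"] by (cases "mat_inverse (submatrix A \<alpha> \<alpha>)") auto
  then have inv: "mat_inverse (submatrix A \<alpha> \<alpha>) = Some N" by (simp add: N_def)
  note N = mat_inverse(2)[OF Aaa inv]
  have P: "ppt A \<alpha> \<in> carrier_mat n n" by (simp add: ppt_def Let_def dims)
  have pk: "pick S k < n" "pick S k \<in> S" "card {a \<in> S. a < pick S k} = k"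
    if "S \<subseteq> {..<n}" "k < card S" for S k
  proof -
    show "pick S k \<in> S" using that by (simp add: pick_in_set_le)
    then show "pick S k < n" using that by auto
    show "card {a \<in> S. a < pick S k} = k" using that by (simp add: card_pick_le)
  qed
  have b: "\<beta> \<subseteq> {..<n}" by (auto simp: \<beta>_def)
  have nb: "i \<notin> \<alpha>" if "i \<in> \<beta>" for i using that by (simp add: \<beta>_def)
  have dP: "dim_row (ppt A \<alpha>) = n" "dim_col (ppt A \<alpha>) = n" using P by auto
  have E: "ppt A \<alpha> $$ (i, j) =
      (if i \<in> \<alpha> then
         if j \<in> \<alpha> then N $$ (card {a \<in> \<alpha>. a < i}, card {a \<in> \<alpha>. a < j})
         else (- (N * submatrix A \<alpha> \<beta>)) $$ (card {a \<in> \<alpha>. a < i}, card {a \<in> \<beta>. a < j})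
       else
         if j \<in> \<alpha> then (submatrix A \<beta> \<alpha> * N) $$ (card {a \<in> \<beta>. a < i}, card {a \<in> \<alpha>. a < j})
         else (submatrix A \<beta> \<beta> - submatrix A \<beta> \<alpha> * N * submatrix A \<alpha> \<beta>)
           $$ (card {a \<in> \<beta>. a < i}, card {a \<in> \<beta>. a < j}))"
    if "i < n" "j < n" for i j
    using that unfolding ppt_def Let_def dims N_def \<beta>_def by simp
  have blk: "submatrix (ppt A \<alpha>) S T = X"
    if "S \<subseteq> {..<n}" "T \<subseteq> {..<n}" "X \<in> carrier_mat (card S) (card T)"
      "\<And>k l. k < card S \<Longrightarrow> l < card T \<Longrightarrow> ppt A \<alpha> $$ (pick S k, pick T l) = X $$ (k, l)" for S T X
  proof -
    have "{i. i < n \<and> i \<in> S} = S" "{i. i < n \<and> i \<in> T} = T" using that by auto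
    then show ?thesis using that by (intro eq_matI) (auto simp: submatrix_def dP)
  qed
  note cs = C[of \<alpha> \<beta>, unfolded set_eq] C[of \<beta> \<alpha>, unfolded set_eq] C[of \<beta> \<beta>, unfolded set_eq] N
  have NC: "N \<in> carrier_mat (card \<alpha>) (card \<alpha>)" using N by simp
  note ncs = mult_carrier_mat[OF NC cs(1)] mult_carrier_mat[OF cs(2) NC]
  note ncs' = mult_carrier_mat[OF ncs(2) cs(1)]
  have aa: "submatrix (ppt A \<alpha>) \<alpha> \<alpha> = N"
    using cs ncs ncs' sub by (intro blk) (auto simp: E pk)
  have ab: "submatrix (ppt A \<alpha>) \<alpha> \<beta> = - (N * submatrix A \<alpha> \<beta>)"
    using cs ncs ncs' sub b nb by (intro blk) (simp_all add: E pk)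
  have ba: "submatrix (ppt A \<alpha>) \<beta> \<alpha> = submatrix A \<beta> \<alpha> * N"
    using cs ncs ncs' sub b nb by (intro blk) (simp_all add: E pk)
  have bb: "submatrix (ppt A \<alpha>) \<beta> \<beta> = submatrix A \<beta> \<beta> - submatrix A \<beta> \<alpha> * N * submatrix A \<alpha> \<beta>"
    using cs ncs ncs' sub b nb by (intro blk) (auto simp: E pk)
  show thesis using that[OF _ _ P aa ab ba bb] N Aaa by (auto simp: inverts_mat_def)
qed

end

theory Submission
  imports Defs
begin

text \<open>
  If \<open>A\<close> is not \<open>P\<^sub>0\<close>, take a principal submatrix \<open>B\<close> of least order with negative determinant. Its
  inverse \<open>N\<close> is a principal submatrix of a principal pivot transform \<open>M\<close> of \<open>A\<close>, and by Jacobi's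
  identity for complementary minors all nonempty principal minors of \<open>N\<close> are nonpositive. The diagonal
  of \<open>M\<close> is nonnegative, and positive if \<open>M\<close> is almost \<open>E\<close> (this needs order at least 2, which holds
  because \<open>A\<close> itself has nonnegative diagonal); so \<open>N\<close> has zero diagonal and the second alternative
  holds for \<open>M\<close>. It excludes every nonzero principal submatrix of order 2 with zero diagonal
  and nonpositive determinant, so \<open>N = 0\<close>, which is absurd.
\<close>

section \<open>Principal minors as Leibniz sums over the original index set\<close>

lemma dim_principal_submatrix [simp]:
  assumes "S \<subseteq> {..<dim_row A}" "dim_col A = dim_row A"
  shows "dim_row (principal_submatrix A S) = card S" "dim_col (principal_submatrix A S) = card S"
proof -
  have "{i. i < dim_row A \<and> i \<in> S} = S" using assms by auto
  then show "dim_row (principal_submatrix A S) = card S"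
    and "dim_col (principal_submatrix A S) = card S"
    using assms by (simp_all add: dim_submatrix)
qed

lemma principal_submatrix_index:
  assumes "S \<subseteq> {..<dim_row A}" "dim_col A = dim_row A" "k < card S" "l < card S"
  shows "principal_submatrix A S $$ (k, l) = A $$ (pick S k, pick S l)"
proof -
  have "{i. i < dim_row A \<and> i \<in> S} = S" using assms by auto
  then show ?thesis using assms by (simp add: submatrix_index)
qed

lemma bij_betw_pick:
  assumes "finite S"
  shows "bij_betw (pick S) {..<card S} S"
proof -
  have inj: "inj_on (pick S) {..<card S}"
  proof (rule inj_on_inverseI)
    fix k assume "k \<in> {..<card S}"
    then show "card {a \<in> S. a < pick S k} = k" by (simp add: card_pick_le)
  qed
  have "pick S ` {..<card S} \<subseteq> S" by (auto simp: pick_in_set_le)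
  moreover have "card (pick S ` {..<card S}) = card S" using inj by (simp add: card_image)
  ultimately show ?thesis using assms inj by (simp add: bij_betw_def card_subset_eq)
qed

text \<open>Carrying permutations along \<open>h\<close> is a bijection that keeps the sign. With
  \<open>f\<close> giving matrix entries, a Leibniz sum over positions turns into one over original
  indices.\<close>

lemma sum_permutations_reindex:
  fixes f :: "nat \<Rightarrow> nat \<Rightarrow> 'a :: comm_ring_1"
  assumes h: "bij_betw h U V" and fin: "finite U"
  shows "(\<Sum>p | p permutes V. signof p * (\<Prod>i\<in>V. f i (p i))) =
    (\<Sum>p | p permutes U. signof p * (\<Prod>i\<in>U. f (h i) (h (p i))))"
proof -
  have inj: "inj_on h U" using h by (simp add: bij_betw_def)
  have inv: "bij_betw (inv_into U h) V U" using h by (rule bij_betw_inv_into)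
  show ?thesis
  proof (rule sum.reindex_bij_witness[of _ "map_permutation U h" "map_permutation V (inv_into U h)"])
    fix p assume "p \<in> {p. p permutes V}"
    then have p: "p permutes V" by simp
    let ?q = "map_permutation V (inv_into U h) p"
    show q: "?q \<in> {p. p permutes U}" using map_permutation_permutes[OF inv p] by simp
    show pq: "map_permutation U h ?q = p"
      using h by (intro map_permutation_compose_inv[OF inv p]) (auto simp: bij_betw_def f_inv_into_f)
    have "signof ?q = (signof p :: 'a)"
      using sign_map_permutation[OF bij_betw_imp_inj_on[OF inv] p] fin bij_betw_finite[OF h] by simp
    moreover have "(\<Prod>i\<in>U. f (h i) (h (?q i))) = (\<Prod>i\<in>U. f (h i) (p (h i)))"
    proof (rule prod.cong[OF refl])
      fix i assume "i \<in> U"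
      then have "p (h i) = h (?q i)"
        by (subst pq[symmetric], rule map_permutation_apply[OF inj])
      then show "f (h i) (h (?q i)) = f (h i) (p (h i))" by simp
    qed
    moreover have "\<dots> = (\<Prod>i\<in>V. f i (p i))" by (rule prod.reindex_bij_betw[OF h])
    ultimately show "signof ?q * (\<Prod>i\<in>U. f (h i) (h (?q i))) = signof p * (\<Prod>i\<in>V. f i (p i))"
      by simp
  next
    fix p assume "p \<in> {p. p permutes U}"
    then have p: "p permutes U" by simp
    show "map_permutation U h p \<in> {p. p permutes V}" using map_permutation_permutes[OF h p] by simp
    show "map_permutation V (inv_into U h) (map_permutation U h p) = p"
      using inj by (intro map_permutation_compose_inv[OF h p]) simp
  qed
qed

text \<open>In this form the renumbering by \<open>pick\<close> disappears from a minor, so minors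
  can be compared through their index sets alone.\<close>

lemma det_principal_submatrix:
  assumes "S \<subseteq> {..<dim_row A}" "dim_col A = dim_row A"
  shows "det (principal_submatrix A S) =
    (\<Sum>p | p permutes S. signof p * (\<Prod>i\<in>S. A $$ (i, p i)))"
proof -
  have fin: "finite S" using assms(1) finite_subset by blast
  let ?k = "card S"
  have "det (principal_submatrix A S) = (\<Sum>p | p permutes {..<?k}.
      signof p * (\<Prod>i<?k. principal_submatrix A S $$ (i, p i)))"
    using assms by (simp add: det_def atLeast0LessThan)
  also have "\<dots> = (\<Sum>p | p permutes {..<?k}. signof p * (\<Prod>i<?k. A $$ (pick S i, pick S (p i))))"
  proof (intro sum.cong refl arg_cong2[of _ _ _ _ "(*)"] prod.cong)
    fix p i assume "p \<in> {p. p permutes {..<?k}}" "i \<in> {..<?k}"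
    then have "p i \<in> {..<?k}" "i \<in> {..<?k}" by (simp_all only: mem_Collect_eq permutes_in_image)
    then show "principal_submatrix A S $$ (i, p i) = A $$ (pick S i, pick S (p i))"
      using assms by (simp add: principal_submatrix_index)
  qed
  also have "\<dots> = (\<Sum>p | p permutes S. signof p * (\<Prod>i\<in>S. A $$ (i, p i)))"
    using sum_permutations_reindex[OF bij_betw_pick[OF fin], of "\<lambda>i j. A $$ (i, j)"] by simp
  finally show ?thesis .
qed

text \<open>Both Leibniz sums range over the same entries of \<open>A\<close>, so the two numberings
  of the rows never have to be matched.\<close>

lemma det_principal_submatrix_twice:
  assumes S: "S \<subseteq> {..<dim_row A}" and sq: "dim_col A = dim_row A" and U: "U \<subseteq> {..<card S}"
  shows "det (principal_submatrix (principal_submatrix A S) U) =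
    det (principal_submatrix A (pick S ` U))"
proof -
  have finS: "finite S" and finU: "finite U" using S U finite_subset by blast+
  have bij: "bij_betw (pick S) U (pick S ` U)"
    using bij_betw_pick[OF finS] U by (meson bij_betw_subset subset_refl)
  have sub: "pick S ` U \<subseteq> {..<dim_row A}" using U S pick_in_set_le by blast
  have "det (principal_submatrix (principal_submatrix A S) U) =
      (\<Sum>p | p permutes U. signof p * (\<Prod>i\<in>U. principal_submatrix A S $$ (i, p i)))"
    using S sq U by (intro det_principal_submatrix) simp_all
  also have "\<dots> = (\<Sum>p | p permutes U. signof p * (\<Prod>i\<in>U. A $$ (pick S i, pick S (p i))))"
  proof (intro sum.cong refl arg_cong2[of _ _ _ _ "(*)"] prod.cong)
    fix p i assume "p \<in> {p. p permutes U}" "i \<in> U"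
    then have "p i \<in> U" "i \<in> U" by (simp_all add: permutes_in_image)
    then have "p i < card S" "i < card S" using U by auto
    then show "principal_submatrix A S $$ (i, p i) = A $$ (pick S i, pick S (p i))"
      using S sq by (simp add: principal_submatrix_index)
  qed
  also have "\<dots> = det (principal_submatrix A (pick S ` U))"
    using sum_permutations_reindex[OF bij finU, of "\<lambda>i j. A $$ (i, j)"]
      det_principal_submatrix[OF sub sq] by simp
  finally show ?thesis .
qed

section \<open>Jacobi's identity for complementary principal minors\<close>

text \<open>A column outside \<open>T\<close> is a unit vector with its 1 on the diagonal. Hence
  only permutations fixing every index outside \<open>T\<close> contribute, and these are the
  permutations of \<open>T\<close>.\<close>

lemma det_unit_columns_outside:
  assumes B: "B \<in> carrier_mat k k" and T: "T \<subseteq> {..<k}"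
  shows "det (mat k k (\<lambda>(i, j). if j \<in> T then B $$ (i, j) else if i = j then 1 else 0)) =
    det (principal_submatrix B T)"
proof -
  let ?W = "mat k k (\<lambda>(i, j). if j \<in> T then B $$ (i, j) else if i = j then 1 else 0)"
  have "det ?W = (\<Sum>p | p permutes {..<k}. signof p * (\<Prod>i<k. ?W $$ (i, p i)))"
    by (simp add: det_def atLeast0LessThan)
  also have "\<dots> = (\<Sum>p | p permutes T. signof p * (\<Prod>i<k. ?W $$ (i, p i)))"
  proof (rule sum.mono_neutral_right)
    show "finite {p. p permutes {..<k}}" by (simp add: finite_permutations)
    show "{p. p permutes T} \<subseteq> {p. p permutes {..<k}}" using T permutes_subset by blast
    show "\<forall>p\<in>{p. p permutes {..<k}} - {p. p permutes T}. signof p * (\<Prod>i<k. ?W $$ (i, p i)) = 0"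
    proof
      fix p assume p: "p \<in> {p. p permutes {..<k}} - {p. p permutes T}"
      then have pk: "p permutes {..<k}" by simp
      have "\<exists>j\<in>{..<k} - T. p j \<noteq> j"
      proof (rule ccontr)
        assume "\<not> ?thesis"
        then have "p permutes T" by (intro permutes_superset[OF pk]) blast
        then show False using p by simp
      qed
      then obtain j where j: "j < k" "j \<notin> T" "p j \<noteq> j" by auto
      \<comment> \<open>Row \<open>i\<close> is the one that \<open>p\<close> sends to column
        \<open>j\<close>; as \<open>i\<close> differs from \<open>j\<close>, its factor is an
        off-diagonal entry of a unit column, hence zero.\<close>
      obtain i where pi: "p i = j" using surjD[OF permutes_surj[OF pk], of j] by auto
      then have "i \<noteq> j" using j by auto
      have "i < k" using pi j pk permutes_in_image[OF pk, of i] by simp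
      then have "?W $$ (i, p i) = 0" using pi j \<open>i \<noteq> j\<close> by simp
      then have "(\<Prod>i<k. ?W $$ (i, p i)) = 0"
        using \<open>i < k\<close> by (intro prod_zero bexI[of _ i]) simp_all
      then show "signof p * (\<Prod>i<k. ?W $$ (i, p i)) = 0" by simp
    qed
  qed
  also have "\<dots> = (\<Sum>p | p permutes T. signof p * (\<Prod>i\<in>T. B $$ (i, p i)))"
  proof (intro sum.cong refl arg_cong2[of _ _ _ _ "(*)"])
    fix p assume "p \<in> {p. p permutes T}"
    then have p: "p permutes T" by simp
    have "(\<Prod>i<k. ?W $$ (i, p i)) = (\<Prod>i\<in>T. ?W $$ (i, p i))"
      using T p by (intro prod.mono_neutral_right) (auto simp: permutes_not_in)
    also have "\<dots> = (\<Prod>i\<in>T. B $$ (i, p i))"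
    proof (rule prod.cong[OF refl])
      fix i assume "i \<in> T"
      then have "p i \<in> T" "i < k" "p i < k" using T p permutes_in_image[OF p, of i] by auto
      then show "?W $$ (i, p i) = B $$ (i, p i)" by simp
    qed
    finally show "(\<Prod>i<k. ?W $$ (i, p i)) = (\<Prod>i\<in>T. B $$ (i, p i))" .
  qed
  also have "\<dots> = det (principal_submatrix B T)"
    using B T by (intro det_principal_submatrix[symmetric]) auto
  finally show ?thesis .
qed

text \<open>Keep the columns of \<open>N\<close> in \<open>T\<close> and replace the others by unit
  vectors. Multiplying by \<open>B\<close> gives unit columns in \<open>T\<close> and columns of
  \<open>B\<close> elsewhere; then take determinants.\<close>

lemma jacobi_complementary_principal_minor:
  fixes B N :: "'a :: comm_ring_1 mat"
  assumes B: "B \<in> carrier_mat k k" and N: "N \<in> carrier_mat k k" and BN: "B * N = 1\<^sub>m k"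
    and T: "T \<subseteq> {..<k}"
  shows "det B * det (principal_submatrix N T) = det (principal_submatrix B ({..<k} - T))"
proof -
  let ?C = "mat k k (\<lambda>(i, j). if j \<in> T then N $$ (i, j) else if i = j then 1 else 0)"
  let ?W = "mat k k (\<lambda>(i, j). if j \<in> {..<k} - T then B $$ (i, j) else if i = j then 1 else 0)"
  have C: "?C \<in> carrier_mat k k" by simp
  have "B * ?C = ?W"
  proof (rule eq_matI)
    fix i j assume "i < dim_row ?W" "j < dim_col ?W"
    then have ij: "i < k" "j < k" by simp_all
    show "(B * ?C) $$ (i, j) = ?W $$ (i, j)"
    proof (cases "j \<in> T")
      case True
      have "col ?C j = col N j" using True ij N by (intro eq_vecI) auto
      then have "(B * ?C) $$ (i, j) = (B * N) $$ (i, j)" using ij B N by simp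
      then show ?thesis using BN True ij by simp
    next
      case False
      have "col ?C j = unit_vec k j" using False ij by (intro eq_vecI) auto
      then have "(B * ?C) $$ (i, j) = row B i \<bullet> unit_vec k j" using ij B by simp
      then show ?thesis using False ij B by simp
    qed
  qed (use B in auto)
  then have "det B * det ?C = det ?W" using det_mult[OF B C] by simp
  moreover have "det ?C = det (principal_submatrix N T)" using N T by (rule det_unit_columns_outside)
  moreover have "det ?W = det (principal_submatrix B ({..<k} - T))"
    using B by (rule det_unit_columns_outside) auto
  ultimately show ?thesis by simp
qed

section \<open>Principal minors of order one and two\<close>

lemma det_principal_submatrix_singleton:
  assumes "i < dim_row A" "dim_col A = dim_row A"
  shows "det (principal_submatrix A {i}) = A $$ (i, i)"
  using assms by (subst det_principal_submatrix) (auto simp: permutes_sing)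

lemma pick_doubleton:
  assumes "a \<noteq> b"
  shows "pick {a, b} 0 = a \<and> pick {a, b} 1 = b \<or> pick {a, b} 0 = b \<and> pick {a, b} 1 = a"
proof -
  have "{..<card {a, b}} = {0, 1}" using assms by auto
  then have "pick {a, b} 0 \<noteq> pick {a, b} 1" "{pick {a, b} 0, pick {a, b} 1} = {a, b}"
    using bij_betw_pick[of "{a, b}"] by (auto simp: bij_betw_def)
  then show ?thesis by (auto simp: doubleton_eq_iff)
qed

lemma det_principal_submatrix_doubleton:
  fixes A :: "'a :: comm_ring_1 mat"
  assumes "a \<noteq> b" "a < dim_row A" "b < dim_row A" "dim_col A = dim_row A"
  shows "det (principal_submatrix A {a, b}) = A $$ (a, a) * A $$ (b, b) - A $$ (a, b) * A $$ (b, a)"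
proof -
  have perms: "{p. p permutes {a, b}} = {id, Transposition.transpose a b}"
    by (auto simp: permutes_doubleton_iff)
  \<comment> \<open>The two permutations must be distinct for the sum over the pair to have two
    terms.\<close>
  have "Transposition.transpose a b a \<noteq> id a" using assms(1) by simp
  then have "id \<noteq> Transposition.transpose a b" by metis
  then show ?thesis
    using assms by (subst det_principal_submatrix) (simp_all add: perms sign_swap_id)
qed

section \<open>Entries of matrices in the classes\<close>

lemma unit_vec_nonneg: "0\<^sub>v m \<le> (unit_vec m i :: real vec)"
  by (auto simp: less_eq_vec_def unit_vec_def)

lemma semimonotone_diag_nonneg:
  assumes B: "B \<in> carrier_mat m m" and sm: "semimonotone B" and i: "i < m"
  shows "0 \<le> B $$ (i, i)"
proof -
  have d: "dim_row B = m" using B by simp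
  \<comment> \<open>The only positive coordinate of the test vector is \<open>i\<close>, so the
    index provided by the class is \<open>i\<close>, where the product is the diagonal
    entry.\<close>
  obtain j where "j < m" "unit_vec m i $ j > (0 :: real)" "(B *\<^sub>v unit_vec m i) $ j \<ge> 0"
    using sm[unfolded semimonotone_def d, rule_format, OF unit_vec_carrier
        conjI[OF unit_vec_nonzero[OF i] unit_vec_nonneg]] by blast
  moreover from this have "j = i" using i by (simp split: if_splits)
  ultimately show ?thesis using B i by simp
qed

lemma strictly_semimonotone_diag_pos:
  assumes B: "B \<in> carrier_mat m m" and sm: "strictly_semimonotone B" and i: "i < m"
  shows "0 < B $$ (i, i)"
proof -
  have d: "dim_row B = m" using B by simp
  obtain j where "j < m" "unit_vec m i $ j > (0 :: real)" "(B *\<^sub>v unit_vec m i) $ j > 0"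
    using sm[unfolded strictly_semimonotone_def d, rule_format, OF unit_vec_carrier
        conjI[OF unit_vec_nonzero[OF i] unit_vec_nonneg]] by blast
  moreover from this have "j = i" using i by (simp split: if_splits)
  ultimately show ?thesis using B i by simp
qed

text \<open>Deleting an index other than \<open>i\<close> leaves an E matrix that still has the
  entry (i, i) on its diagonal. Order 1 is a true exception: the matrix (0) is almost E.\<close>

lemma almost_E_diag_pos:
  assumes M: "M \<in> carrier_mat n n" and ae: "almost_E M" and n: "2 \<le> n" and i: "i < n"
  shows "0 < M $$ (i, i)"
proof -
  obtain j where j: "j < n" "j \<noteq> i"
    using n that[of "if i = 0 then 1 else 0"] by (auto split: if_splits)
  define S where "S = {..<n} - {j}"
  have S: "S \<subseteq> {..<dim_row M}" "Suc (card S) = dim_row M" "i \<in> S"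
    using M j i by (auto simp: S_def card_Diff_singleton)
  have "strictly_semimonotone (principal_submatrix M S)" using ae S by (simp add: almost_E_def)
  moreover have sq: "dim_col M = dim_row M" using M by simp
  ultimately have pos: "0 < principal_submatrix M S $$ (k, k)" if "k < card S" for k
    using that S by (intro strictly_semimonotone_diag_pos[of _ "card S"]) auto
  have "finite S" by (simp add: S_def)
  then have "i \<in> pick S ` {..<card S}" using bij_betw_pick[of S] S(3) by (simp add: bij_betw_def)
  then obtain k where "k < card S" "pick S k = i" by auto
  then show ?thesis using pos[of k] S(1) sq by (simp add: principal_submatrix_index)
qed

lemma completely_semimonotone_star_tilde_diag_nonneg:
  assumes M: "M \<in> carrier_mat n n" and c: "completely_semimonotone_star_tilde M" and i: "i < n"
  shows "0 \<le> M $$ (i, i)"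
proof -
  have "semimonotone (principal_submatrix M {i})"
    using c M i by (auto simp: completely_semimonotone_star_tilde_def
      semimonotone_star_tilde_def semimonotone_star_def)
  then have "0 \<le> principal_submatrix M {i} $$ (0, 0)"
    using M i by (intro semimonotone_diag_nonneg[of _ 1]) auto
  moreover have "pick {i} 0 = i" using pick_in_set_le[of 0 "{i}"] by simp
  ultimately show ?thesis using M i by (simp add: principal_submatrix_index)
qed

text \<open>Let b, c be the off-diagonal entries (0, 1) and (1, 0). If c \<ge> 0, the first unit
  vector lies in \<open>SOL0 P\<close>, so b \<le> 0, and b = 0 if c = 0. If c > 0, then bc \<ge> 0
  forces b = 0, and the second unit vector gives c \<le> 0, a contradiction. The case b \<ge> 0 is
  symmetric.\<close>

lemma semimonotone_star_tilde_2_zero_diag: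
  assumes P: "P \<in> carrier_mat 2 2" and t: "semimonotone_star_tilde P"
    and d: "P $$ (0, 0) = 0" "P $$ (1, 1) = 0" and bc: "0 \<le> P $$ (0, 1) * P $$ (1, 0)"
  shows "P $$ (0, 1) = 0 \<and> P $$ (1, 0) = 0"
proof -
  have *: "0 \<le> P $$ (j, i) \<Longrightarrow> P $$ (i, j) \<le> 0 \<and> (P $$ (i, j) \<noteq> 0 \<longrightarrow> P $$ (j, i) \<noteq> 0)"
    if ij: "i < 2" "j < 2" "i \<noteq> j" for i j
  proof -
    assume nonneg: "0 \<le> P $$ (j, i)"
    have dd: "P $$ (l, l) = 0" if "l < 2" for l using d that by (auto simp: less_2_cases_iff)
    have two: "l = i \<or> l = j" if "l < 2" for l using ij that by auto
    have mult: "(P *\<^sub>v unit_vec 2 i) $ l = P $$ (l, i)"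
      and multT: "(transpose_mat P *\<^sub>v unit_vec 2 i) $ l = P $$ (i, l)" if "l < 2" for l
      using P that ij(1) by simp_all
    have dims: "dim_row P = 2" "dim_col P = 2" using P by auto
    have "0 \<le> P $$ (l, i)" if "l < 2" for l using two[OF that] dd[OF that] nonneg by auto
    then have "0\<^sub>v 2 \<le> P *\<^sub>v unit_vec 2 i"
      using mult dims by (simp add: less_eq_vec_def)
    moreover have "unit_vec 2 i \<bullet> (P *\<^sub>v unit_vec 2 i) = 0"
      using mult[OF ij(1)] dd[OF ij(1)] ij(1) P by (subst scalar_prod_left_unit) auto
    ultimately have "unit_vec 2 i \<in> SOL0 P"
      using dims unit_vec_nonneg by (simp add: SOL0_def)
    then have "transpose_mat P *\<^sub>v unit_vec 2 i \<le> 0\<^sub>v 2"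
      and "(transpose_mat P *\<^sub>v unit_vec 2 i) $ j \<noteq> 0 \<longrightarrow> (P *\<^sub>v unit_vec 2 i) $ j \<noteq> 0"
      using t dims ij by (auto simp: semimonotone_star_tilde_def semimonotone_star_def)
    then show ?thesis using mult[OF ij(2)] multT[OF ij(2)] ij(2) dims
      by (auto simp: less_eq_vec_def)
  qed
  have "0 \<le> P $$ (0, 1) \<or> 0 \<le> P $$ (1, 0)"
  proof -
    \<comment> \<open>On the all-ones vector, semimonotonicity says that some row sum is
      nonnegative; with zero diagonal the row sums are the off-diagonal entries.\<close>
    define x :: "real vec" where "x = vec 2 (\<lambda>_. 1)"
    have x: "x \<in> carrier_vec 2" "0\<^sub>v 2 \<le> x" "x \<noteq> 0\<^sub>v 2"
      by (auto simp: x_def less_eq_vec_def vec_eq_iff intro!: exI[of _ 0])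
    have "semimonotone P" using t by (simp add: semimonotone_star_tilde_def semimonotone_star_def)
    then obtain i where i: "i < 2" "0 \<le> (P *\<^sub>v x) $ i"
      using x P unfolding semimonotone_def by (metis carrier_matD(1))
    moreover have "(P *\<^sub>v x) $ i = P $$ (i, 0) + P $$ (i, 1)" if "i < 2" for i
      using that P by (simp add: x_def scalar_prod_def numeral_2_eq_2)
    ultimately show ?thesis using d by (auto simp: less_2_cases_iff)
  qed
  then show ?thesis
    using *[of 0 1] *[of 1 0] bc by (auto simp: zero_le_mult_iff)
qed

theorem theorem20:
  fixes A :: "real mat" and n :: nat
  assumes "A \<in> carrier_mat n n"
    and "semimonotone_star_tilde A"
    and "\<forall>M \<in> legitimate_ppts A. almost_E M \<or> completely_semimonotone_star_tilde M"
  shows "P0_matrix A"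
proof (rule ccontr)
  note A = assms(1)
  have dA: "dim_row A = n" "dim_col A = n" using A by auto
  assume "\<not> P0_matrix A"
  then obtain R where "R \<subseteq> {..<n} \<and> det (principal_submatrix A R) < 0"
    by (auto simp: P0_matrix_def dA not_le)
  from ex_has_least_nat[of "\<lambda>S. S \<subseteq> {..<n} \<and> det (principal_submatrix A S) < 0", OF this, of card]
  obtain S where S: "S \<subseteq> {..<n}" "det (principal_submatrix A S) < 0"
    and least: "\<And>R. R \<subseteq> {..<n} \<and> det (principal_submatrix A R) < 0 \<Longrightarrow> card S \<le> card R"
    by auto
  have minimal: "0 \<le> det (principal_submatrix A R)" if "card R < card S" "R \<subseteq> {..<n}" for R
    using least[of R] that by force
  define k where "k = card S"
  define B where "B = principal_submatrix A S"
  have finS: "finite S" using S(1) finite_subset by blast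
  have B: "B \<in> carrier_mat k k" using S(1) dA by (auto simp: B_def k_def)
  have detB: "det B < 0" using S(2) by (simp add: B_def)
  \<comment> \<open>A proper principal minor of \<open>B\<close> is a principal minor of
    \<open>A\<close> of smaller order, so minimality applies.\<close>
  have minorB: "0 \<le> det (principal_submatrix B U)" if U: "U \<subset> {..<k}" for U
  proof -
    have "det (principal_submatrix B U) = det (principal_submatrix A (pick S ` U))"
      using S(1) U dA by (simp add: B_def k_def det_principal_submatrix_twice)
    moreover have "card (pick S ` U) < card S"
      using U psubset_card_mono[OF _ U] card_image_le[of U "pick S"] finite_subset[of U "{..<k}"]
      by (fastforce simp: k_def)
    moreover have "pick S ` U \<subseteq> {..<n}" using U S(1) pick_in_set_le by (force simp: k_def)
    ultimately show ?thesis using minimal by simp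
  qed
  have k2: "2 \<le> k"
  proof (rule ccontr)
    assume "\<not> 2 \<le> k"
    then have "k = 0 \<or> k = 1" by auto
    then show False
    proof
      assume "k = 0"
      then have "det B = 1" using B by (intro det_dim_zero) auto
      then show False using detB by simp
    next
      assume "k = 1"
      then obtain i where i: "S = {i}" "i < n" using S(1) by (auto simp: k_def card_1_singleton_iff)
      have "semimonotone A" using assms(2) by (simp add: semimonotone_star_tilde_def semimonotone_star_def)
      then have "0 \<le> A $$ (i, i)" using A i by (intro semimonotone_diag_nonneg)
      then show False using S(2) i dA by (simp add: det_principal_submatrix_singleton)
    qed
  qed
  have n2: "2 \<le> n" using k2 S(1) card_mono[of "{..<n}" S] by (simp add: k_def)
  define M where "M = ppt A S"
  have "det (principal_submatrix A S) \<noteq> 0" using S(2) by simp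
  from ppt_blocks[OF A S(1) this]
  obtain N where inv: "inverts_mat B N" and M: "M \<in> carrier_mat n n" and N_def: "principal_submatrix M S = N"
    unfolding B_def M_def by metis
  have dM: "dim_row M = n" "dim_col M = n" using M by auto
  have N: "N \<in> carrier_mat k k" using S(1) dM by (auto simp: N_def[symmetric] k_def)
  have BN: "B * N = 1\<^sub>m k" using inv B by (simp add: inverts_mat_def)
  have "M \<in> legitimate_ppts A" using S dA by (auto simp: legitimate_ppts_def M_def)
  then have M_class: "almost_E M \<or> completely_semimonotone_star_tilde M" using assms(3) by blast
  \<comment> \<open>For nonempty \<open>T\<close> the complement is proper, so its minor in
    \<open>B\<close> is nonnegative; dividing by \<open>det B\<close> < 0 reverses the sign.\<close>
  have minorN: "det (principal_submatrix N T) \<le> 0" if T: "T \<subseteq> {..<k}" "T \<noteq> {}" for T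
  proof -
    have "{..<k} - T \<subset> {..<k}" using T by auto
    then have "0 \<le> det B * det (principal_submatrix N T)"
      using jacobi_complementary_principal_minor[OF B N BN T(1)] minorB by simp
    then show ?thesis using detB by (simp add: zero_le_mult_iff)
  qed
  have pickS: "pick S a < n" if "a < k" for a using that S(1) pick_in_set_le by (force simp: k_def)
  have N_index: "N $$ (a, b) = M $$ (pick S a, pick S b)" if "a < k" "b < k" for a b
    using that S(1) dM by (simp add: N_def[symmetric] k_def principal_submatrix_index)
  have N_diag: "N $$ (a, a) \<le> 0" if "a < k" for a
    using minorN[of "{a}"] that N by (simp add: det_principal_submatrix_singleton)
  have "\<not> almost_E M"
    using almost_E_diag_pos[OF M _ n2 pickS[of 0]] N_diag[of 0] N_index[of 0 0] k2 by fastforce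
  then have M_tilde: "completely_semimonotone_star_tilde M" using M_class by simp
  have N_diag0: "N $$ (a, a) = 0" if "a < k" for a
    using completely_semimonotone_star_tilde_diag_nonneg[OF M M_tilde pickS[OF that]]
      N_diag[OF that] N_index[OF that that] by simp
  have N_zero: "N $$ (a, b) = 0 \<and> N $$ (b, a) = 0" if ab: "a < b" "b < k" for a b
  proof -
    let ?T = "pick S ` {a, b}"
    let ?P = "principal_submatrix M ?T"
    have ne: "pick S a \<noteq> pick S b"
      using bij_betw_pick[OF finS] ab by (auto simp: bij_betw_def k_def dest: inj_onD)
    have T: "?T \<subseteq> {..<n}" using pickS ab by auto
    have card: "card ?T = 2" using ne by simp
    have P: "?P \<in> carrier_mat 2 2" using T card dM by (intro carrier_matI) simp_all
    \<comment> \<open>With zero diagonal, the minor of order two is minus this product.\<close>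
    have "0 \<le> N $$ (a, b) * N $$ (b, a)"
      using minorN[of "{a, b}"] ab N N_diag0 by (simp add: det_principal_submatrix_doubleton)
    then have bc: "0 \<le> M $$ (pick S a, pick S b) * M $$ (pick S b, pick S a)"
      using N_index ab by simp
    have d: "M $$ (pick S a, pick S a) = 0" "M $$ (pick S b, pick S b) = 0"
      using N_diag0 N_index ab by auto
    have entry: "?P $$ (c, e) = M $$ (pick ?T c, pick ?T e)" if "c < 2" "e < 2" for c e
      using T card dM that by (simp only: principal_submatrix_index)
    have tilde: "semimonotone_star_tilde ?P"
      using M_tilde T dM by (simp add: completely_semimonotone_star_tilde_def)
    \<comment> \<open>Either order of the two indices within \<open>?T\<close> will do, because the
      hypotheses and the conclusion about the pair are symmetric.\<close>
    obtain c e where "pick ?T 0 = c" "pick ?T 1 = e"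
      and "c = pick S a \<and> e = pick S b \<or> c = pick S b \<and> e = pick S a"
      using pick_doubleton[OF ne] by auto
    then have "M $$ (pick S a, pick S b) = 0 \<and> M $$ (pick S b, pick S a) = 0"
      using semimonotone_star_tilde_2_zero_diag[OF P tilde] d bc
        entry[of 0 0] entry[of 0 1] entry[of 1 0] entry[of 1 1]
      by (auto simp: mult.commute simp del: pick.simps One_nat_def)
    then show ?thesis using N_index ab by simp
  qed
  \<comment> \<open>A zero \<open>N\<close> makes \<open>B * N\<close> zero, whereas it is the
    identity of order at least 2.\<close>
  have "N = 0\<^sub>m k k"
  proof (rule eq_matI)
    fix a b assume "a < dim_row (0\<^sub>m k k :: real mat)" "b < dim_col (0\<^sub>m k k :: real mat)"
    then have "a < k" "b < k" by simp_all
    then show "N $$ (a, b) = 0\<^sub>m k k $$ (a, b)"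
      using N_diag0[of a] N_zero[of a b] N_zero[of b a] by (cases a b rule: linorder_cases) auto
  qed (use N in auto)
  then have "1\<^sub>m k = (0\<^sub>m k k :: real mat)" using BN B by simp
  then have "(1\<^sub>m k :: real mat) $$ (0, 0) = 0\<^sub>m k k $$ (0, 0)" by simp
  then show False using k2 by simp
qed

end
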